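(* Given $(\beta,\alpha)\in\Delta$ with $\Omega_{\beta,\alpha}$ a subshift of finite type, and $\xi\in[0,1]$, the set $$\mathrm{BAD}_{\beta,\alpha}(\xi)=\{x\in[0,1]\colon\xi\notin\overline{\{T_{\beta,\alpha}^{n}(x)\colon n\ge 0\}}\}$$ is winning.
   Context: $\Delta=\{(b,a)\in\mathbb{R}^2\colon b\in(1,2),\ a\in[0,2-b]\}$. For $(\beta,\alpha)\in\Delta$, $T_{\beta,\alpha}\colon[0,1]\to[0,1]$, $T_{\beta,\alpha}(x)=\beta x+\alpha\bmod 1$, and $p_{\beta,\alpha}=(1-\alpha)/\beta$. The upper expansion $\tau^{+}_{\beta,\alpha}(x)=\omega_1\omega_2\cdots\in\{0,1\}^{\mathbb{N}}$ is defined by $\omega_n=0$ if $T_{\beta,\alpha}^{n-1}(x)<p_{\beta,\alpha}$ and $\omega_n=1$ otherwise; the lower expansion is $\tau^{-}_{\beta,\alpha}(x)=\lim_{y\nearrow x}\tau^{+}_{\beta,\alpha}(y)$. The intermediate $\beta$-shift is $\Omega_{\beta,\alpha}=\tau^{+}_{\beta,\alpha}([0,1))\cup\tau^{-}_{\beta,\alpha}((0,1])$. It is of finite type if it is the set of all sequences in $\{0,1\}^{\mathbb{N}}$ in which no word of some finite set of forbidden finite words occurs. Winning (Schmidt game): let $a,\gamma\in(0,1)$ be fixed. Player 2 chooses a closed initial interval $B_1\subset[0,1]$ of positive length, and then Player 1 and Player 2 alternately choose nested closed intervals $B_1\supset W_1\supset B_2\supset W_2\supset\cdots$ with $|W_n|=a|B_n|$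 (chosen by Player 1) and $|B_{n+1}|=\gamma|W_n|$ (chosen by Player 2). A set $S$ is $(a,\gamma)$-winning if Player 1 has a strategy ensuring $\bigcap_{i\in\mathbb{N}}W_i\subset S$. The set $S$ is $a$-winning if it is $(a,\gamma)$-winning for all $\gamma\in(0,1)$, and winning if it is $a$-winning for some $a\in(0,1)$. *)

theory Defs
  imports "HOL-Analysis.Analysis"
begin

section \<open>Intermediate beta-transformations and beta-shifts\<close>

definition param_region :: "(real \<times> real) set" where
  "param_region = {(b, a). b \<in> {1<..<2} \<and> a \<in> {0..2 - b}}"

definition beta_map :: "real \<Rightarrow> real \<Rightarrow> real \<Rightarrow> real" where
  "beta_map \<beta> \<alpha> x = frac (\<beta> * x + \<alpha>)"

definition crit_point :: "real \<Rightarrow> real \<Rightarrow> real" where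
  "crit_point \<beta> \<alpha> = (1 - \<alpha>) / \<beta>"

text \<open>
  Elements of the full shift are functions from the naturals with values in \<open>{0, 1}\<close>; letters are
  indexed from 0, so the letter at index \<open>n\<close> is the letter number \<open>n + 1\<close> in one-based notation.
\<close>

definition upper_expansion :: "real \<Rightarrow> real \<Rightarrow> real \<Rightarrow> nat \<Rightarrow> nat" where
  "upper_expansion \<beta> \<alpha> x = (\<lambda>n. if (beta_map \<beta> \<alpha> ^^ n) x < crit_point \<beta> \<alpha> then 0 else 1)"

text \<open>
  The limit is taken in the product topology on functions, the type \<open>nat\<close> of letters being
  discrete. The library constant \<open>Lim\<close> does not apply, since it needs a \<open>t2_space\<close> instance that this
  function type lacks; the lemma below shows that the limit exists and is unique. It is used only for \<open>0 < x \<le> 1\<close>, where points just to the left of \<open>x\<close> lie in \<open>(0, 1)\<close>.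
\<close>

definition lower_expansion :: "real \<Rightarrow> real \<Rightarrow> real \<Rightarrow> nat \<Rightarrow> nat" where
  "lower_expansion \<beta> \<alpha> x = (THE \<omega>. (upper_expansion \<beta> \<alpha> \<longlongrightarrow> \<omega>) (at_left x))"

lemma filterlim_beta_map_at_left:
  fixes z :: real
  assumes "\<beta> > 0"
  shows "\<exists>w. filterlim (beta_map \<beta> \<alpha>) (at_left w) (at_left z)"
proof -
  define v where "v = \<beta> * z + \<alpha>"
  define k where "k = \<lceil>v\<rceil> - 1"
  have kv: "of_int k < v" "v \<le> of_int k + 1"
    unfolding k_def by linarith+
  have aff: "((\<lambda>y. \<beta> * y + \<alpha>) \<longlongrightarrow> v) (at_left z)"
    unfolding v_def by (intro tendsto_intros)
  have lt: "\<forall>\<^sub>F y in at_left z. \<beta> * y + \<alpha> < v"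
    unfolding eventually_at_filter v_def using assms by (auto intro!: always_eventually)
  have gt: "\<forall>\<^sub>F y in at_left z. of_int k < \<beta> * y + \<alpha>"
    using order_tendstoD(1)[OF aff kv(1)] .
  have eq: "\<forall>\<^sub>F y in at_left z. beta_map \<beta> \<alpha> y = \<beta> * y + \<alpha> - of_int k"
    using lt gt
  proof eventually_elim
    case (elim y)
    then have "\<lfloor>\<beta> * y + \<alpha>\<rfloor> = k"
      using kv by (intro floor_unique) auto
    then show ?case
      by (simp add: beta_map_def frac_def)
  qed
  have "((\<lambda>y. \<beta> * y + \<alpha> - of_int k) \<longlongrightarrow> v - of_int k) (at_left z)"
    by (intro tendsto_intros aff)
  then have "(beta_map \<beta> \<alpha> \<longlongrightarrow> v - of_int k) (at_left z)"
    using tendsto_cong[OF eq] by simp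
  moreover have "\<forall>\<^sub>F y in at_left z. beta_map \<beta> \<alpha> y \<in> {..<v - of_int k} \<and> beta_map \<beta> \<alpha> y \<noteq> v - of_int k"
    using eq lt by eventually_elim auto
  ultimately have "filterlim (beta_map \<beta> \<alpha>) (at_left (v - of_int k)) (at_left z)"
    by (simp add: filterlim_at)
  then show ?thesis ..
qed

lemma tendsto_lower_expansion:
  assumes "\<beta> > 0"
  shows "(upper_expansion \<beta> \<alpha> \<longlongrightarrow> lower_expansion \<beta> \<alpha> x) (at_left x)"
proof -
  have iter: "\<exists>w. filterlim (beta_map \<beta> \<alpha> ^^ n) (at_left w) (at_left x)" for n
  proof (induction n)
    case 0
    show ?case by (auto simp: id_def intro!: exI[of _ x] filterlim_ident)
  next
    case (Suc n)
    then obtain w where w: "filterlim (beta_map \<beta> \<alpha> ^^ n) (at_left w) (at_left x)" ..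
    obtain w' where "filterlim (beta_map \<beta> \<alpha>) (at_left w') (at_left w)"
      using filterlim_beta_map_at_left[OF assms] ..
    from filterlim_compose[OF this w] show ?case by (auto simp: o_def)
  qed
  have "\<exists>c. \<forall>\<^sub>F y in at_left x. upper_expansion \<beta> \<alpha> y n = c" for n
  proof -
    obtain w where w: "filterlim (beta_map \<beta> \<alpha> ^^ n) (at_left w) (at_left x)"
      using iter ..
    show ?thesis
    proof (cases "w \<le> crit_point \<beta> \<alpha>")
      case True
      then have "\<forall>\<^sub>F u in at_left w. u < crit_point \<beta> \<alpha>"
        unfolding eventually_at_filter by (auto intro!: always_eventually)
      with w have "\<forall>\<^sub>F y in at_left x. (beta_map \<beta> \<alpha> ^^ n) y < crit_point \<beta> \<alpha>"
        by (auto simp: filterlim_iff)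
      then show ?thesis
        by (intro exI[of _ 0], eventually_elim) (simp add: upper_expansion_def)
    next
      case False
      then have "\<forall>\<^sub>F u in at_left w. u > crit_point \<beta> \<alpha>"
        by (intro order_tendstoD(1)[OF tendsto_ident_at]) simp
      with w have "\<forall>\<^sub>F y in at_left x. (beta_map \<beta> \<alpha> ^^ n) y > crit_point \<beta> \<alpha>"
        by (auto simp: filterlim_iff)
      then show ?thesis
        by (intro exI[of _ 1], eventually_elim) (simp add: upper_expansion_def)
    qed
  qed
  then obtain \<omega> where \<omega>: "\<And>n. \<forall>\<^sub>F y in at_left x. upper_expansion \<beta> \<alpha> y n = \<omega> n"
    by metis
  have coord: "((\<lambda>y. upper_expansion \<beta> \<alpha> y n) \<longlongrightarrow> \<rho> n) (at_left x)"
    if "(upper_expansion \<beta> \<alpha> \<longlongrightarrow> \<rho>) (at_left x)" for \<rho> n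
    using that unfolding tendsto_def
  proof (intro allI impI)
    fix S :: "nat set"
    assume lim: "\<forall>S. open S \<longrightarrow> \<rho> \<in> S \<longrightarrow> (\<forall>\<^sub>F y in at_left x. upper_expansion \<beta> \<alpha> y \<in> S)"
      and S: "open S" "\<rho> n \<in> S"
    have op: "open ((\<lambda>f :: nat \<Rightarrow> nat. f n) -` S)"
      using open_vimage[OF S(1) continuous_on_product_coordinates] .
    from lim[rule_format, OF op] S(2)
    show "\<forall>\<^sub>F y in at_left x. upper_expansion \<beta> \<alpha> y n \<in> S"
      by simp
  qed
  have lim: "(upper_expansion \<beta> \<alpha> \<longlongrightarrow> \<omega>) (at_left x)"
    unfolding tendsto_def
  proof (intro allI impI)
    fix S :: "(nat \<Rightarrow> nat) set"
    assume "open S" "\<omega> \<in> S"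
    then obtain X where X: "\<omega> \<in> Pi\<^sub>E UNIV X" "finite {i. X i \<noteq> UNIV}" "Pi\<^sub>E UNIV X \<subseteq> S"
      using product_topology_open_contains_basis[of "\<lambda>_. euclidean" UNIV S \<omega>]
      by (auto simp: open_fun_def)
    have "\<forall>\<^sub>F y in at_left x. \<forall>i\<in>{i. X i \<noteq> UNIV}. upper_expansion \<beta> \<alpha> y i = \<omega> i"
      by (rule eventually_ball_finite[OF X(2)]) (simp add: \<omega>)
    then show "\<forall>\<^sub>F y in at_left x. upper_expansion \<beta> \<alpha> y \<in> S"
    proof eventually_elim
      case (elim y)
      have "upper_expansion \<beta> \<alpha> y i \<in> X i" for i
        using elim X(1) by (cases "X i = UNIV") (auto simp: PiE_iff)
      then show ?case using X(3) by auto
    qed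
  qed
  have uniq: "\<rho> = \<omega>" if "(upper_expansion \<beta> \<alpha> \<longlongrightarrow> \<rho>) (at_left x)" for \<rho>
  proof
    fix n
    show "\<rho> n = \<omega> n"
      using tendsto_unique[OF _ coord[OF that] coord[OF lim]] by simp
  qed
  show ?thesis
    unfolding lower_expansion_def
    by (rule theI[where P = "\<lambda>\<omega>. (upper_expansion \<beta> \<alpha> \<longlongrightarrow> \<omega>) (at_left x)", OF lim uniq])
qed

definition intermediate_beta_shift :: "real \<Rightarrow> real \<Rightarrow> (nat \<Rightarrow> nat) set" where
  "intermediate_beta_shift \<beta> \<alpha> =
     upper_expansion \<beta> \<alpha> ` {0..<1} \<union> lower_expansion \<beta> \<alpha> ` {0<..1}"

definition occurs_in :: "nat list \<Rightarrow> (nat \<Rightarrow> nat) \<Rightarrow> bool" where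
  "occurs_in w \<omega> \<longleftrightarrow> (\<exists>k. \<forall>i<length w. \<omega> (k + i) = w ! i)"

definition finite_type :: "(nat \<Rightarrow> nat) set \<Rightarrow> bool" where
  "finite_type \<Omega> \<longleftrightarrow>
     (\<exists>F. finite F \<and> F \<subseteq> lists {0, 1} \<and>
          \<Omega> = {\<omega>. range \<omega> \<subseteq> {0, 1} \<and> (\<forall>w\<in>F. \<not> occurs_in w \<omega>)})"

definition BAD :: "real \<Rightarrow> real \<Rightarrow> real \<Rightarrow> real set" where
  "BAD \<beta> \<alpha> \<xi> = {x \<in> {0..1}. \<xi> \<notin> closure (range (\<lambda>n. (beta_map \<beta> \<alpha> ^^ n) x))}"

section \<open>Schmidt's game on the unit interval\<close>

definition closed_interval :: "real set \<Rightarrow> bool" where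
  "closed_interval I \<longleftrightarrow> (\<exists>l u. l < u \<and> I = {l..u})"

text \<open>
  Rounds are numbered from 0: in round \<open>n\<close> Player 2 chooses \<open>B n\<close> and then Player 1 chooses \<open>W n\<close>.
\<close>

definition legal2 :: "real \<Rightarrow> (nat \<Rightarrow> real set) \<Rightarrow> (nat \<Rightarrow> real set) \<Rightarrow> nat \<Rightarrow> bool" where
  "legal2 \<gamma> B W n \<longleftrightarrow> closed_interval (B n) \<and>
     (case n of
        0 \<Rightarrow> B 0 \<subseteq> {0..1}
      | Suc m \<Rightarrow> B (Suc m) \<subseteq> W m \<and> measure lborel (B (Suc m)) = \<gamma> * measure lborel (W m))"

definition legal1 :: "real \<Rightarrow> (nat \<Rightarrow> real set) \<Rightarrow> (nat \<Rightarrow> real set) \<Rightarrow> nat \<Rightarrow> bool" where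
  "legal1 a B W n \<longleftrightarrow> closed_interval (W n) \<and> W n \<subseteq> B n \<and>
     measure lborel (W n) = a * measure lborel (B n)"

text \<open>
  A strategy \<open>\<sigma>\<close> of Player 1 maps the list of all moves made so far by Player 2 to the next move of
  Player 1; his own earlier moves are then determined by \<open>\<sigma>\<close>. The strategy must answer legally
  after every finite legal sequence of moves of Player 2, not just along infinite legal plays:
  otherwise Player 1 could win by an illegal move that leaves Player 2 without an answer.
\<close>

definition game_winning :: "real \<Rightarrow> real \<Rightarrow> real set \<Rightarrow> bool" where
  "game_winning a \<gamma> S \<longleftrightarrow>
     (\<exists>\<sigma> :: real set list \<Rightarrow> real set. \<forall>B W. (\<forall>n. W n = \<sigma> (map B [0..<Suc n])) \<longrightarrow>
        (\<forall>n. (\<forall>k\<le>n. legal2 \<gamma> B W k) \<longrightarrow> legal1 a B W n) \<and>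
        ((\<forall>n. legal2 \<gamma> B W n) \<longrightarrow> (\<Inter>n. W n) \<subseteq> S))"

definition parameter_winning :: "real \<Rightarrow> real set \<Rightarrow> bool" where
  "parameter_winning a S \<longleftrightarrow> (\<forall>\<gamma>\<in>{0<..<1}. game_winning a \<gamma> S)"

definition winning :: "real set \<Rightarrow> bool" where
  "winning S \<longleftrightarrow> (\<exists>a\<in>{0<..<1}. parameter_winning a S)"

end

theory Submission
  imports Defs
begin

text \<open>
  For a shift of finite type the orbit of 0 and the left-hand orbit of 1 are finite, hence bounded
  away from the discontinuity \<open>p\<close> except where they hit it. Therefore, on an interval \<open>I\<close> with
  \<open>\<beta> ^ k * |I| \<le> c\<close>, the map \<open>T ^^ k\<close> has at most two affine branches of slope \<open>\<beta> ^ k\<close>, and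
  \<open>|T ^^ k x - \<xi>| \<ge> \<delta>\<close> holds as soon as \<open>x\<close> stays \<open>\<delta> / \<beta> ^ k\<close> away from boundedly many target points.
  In each round of the game boundedly many new targets become relevant, namely those of the orders
  \<open>k\<close> for which \<open>c / \<beta> ^ k\<close> is comparable to the current length. Player 1, who always answers with
  the left or the right quarter, can halve the weighted number of pending targets in every round, so
  each target is left behind within a bounded number of rounds.
\<close>

section \<open>A strategy for Schmidt's game\<close>

definition left_quarter :: "real set \<Rightarrow> real set" where
  "left_quarter I = {Inf I .. Inf I + (Sup I - Inf I) / 4}"

definition right_quarter :: "real set \<Rightarrow> real set" where
  "right_quarter I = {Sup I - (Sup I - Inf I) / 4 .. Sup I}"

text \<open>The concentric open interval of three times the length: a point outside it keeps at
  least the length of \<open>I\<close> away from all of \<open>I\<close>.\<close>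

definition enlarge :: "real set \<Rightarrow> real set" where
  "enlarge I = {2 * Inf I - Sup I <..< 2 * Sup I - Inf I}"

text \<open>A potential function. \<open>X\<close> applied to a history gives the targets issued by
  its last move, and a target still in \<open>U\<close> weighs 3/2 to the power of its age. A base
  above 1 makes old targets expensive; a base below 2 lets halving outrun the growth.\<close>

definition threat :: "(real set list \<Rightarrow> real set) \<Rightarrow> real set list \<Rightarrow> real set \<Rightarrow> real" where
  "threat X bs U =
     (\<Sum>i<length bs. (3/2) ^ (length bs - Suc i) * real (card (X (take (Suc i) bs) \<inter> U)))"

definition quarter_strategy :: "(real set list \<Rightarrow> real set) \<Rightarrow> real set list \<Rightarrow> real set" where
  "quarter_strategy X bs =
     (if threat X bs (enlarge (left_quarter (last bs)))
           \<le> threat X bs (enlarge (right_quarter (last bs)))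
      then left_quarter (last bs) else right_quarter (last bs))"

lemma quarter_strategy_cases:
  "quarter_strategy X bs = left_quarter (last bs) \<or> quarter_strategy X bs = right_quarter (last bs)"
  by (simp add: quarter_strategy_def)

lemma quarter_legal:
  assumes "closed_interval I" and "J = left_quarter I \<or> J = right_quarter I"
  shows "closed_interval J" "J \<subseteq> I" "measure lborel J = 1/4 * measure lborel I"
proof -
  obtain l u where lu: "l < u" "I = {l..u}"
    using assms(1) by (auto simp: closed_interval_def)
  have lr: "left_quarter I = {l .. l + (u - l) / 4}" "right_quarter I = {u - (u - l) / 4 .. u}"
    using lu by (simp_all add: left_quarter_def right_quarter_def)
  show "closed_interval J"
    using assms(2) lu(1) unfolding closed_interval_def lr by fastforce
  show "J \<subseteq> I" using assms(2) lu unfolding lr by (auto simp: field_simps)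
  show "measure lborel J = 1/4 * measure lborel I"
    using assms(2) lu unfolding lr by auto
qed

lemma legal1_quarter:
  assumes "closed_interval (B n)" and "W n = left_quarter (B n) \<or> W n = right_quarter (B n)"
  shows "legal1 (1/4) B W n"
  unfolding legal1_def by (simp only: quarter_legal[OF assms] simp_thms)

text \<open>The enlarged quarters are open and meet the midpoint of \<open>I\<close> only as a
  common endpoint; they protrude from \<open>I\<close> by a quarter of its length. One quarter is
  the largest ratio with this disjointness.\<close>

lemma enlarge_quarters:
  assumes "closed_interval I"
  shows "enlarge (left_quarter I) \<inter> enlarge (right_quarter I) = {}"
    and "enlarge (left_quarter I) \<union> enlarge (right_quarter I) \<subseteq> enlarge I"
proof -
  obtain l u where lu: "l < u" "I = {l..u}"
    using assms(1) by (auto simp: closed_interval_def)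
  then show "enlarge (left_quarter I) \<inter> enlarge (right_quarter I) = {}"
    "enlarge (left_quarter I) \<union> enlarge (right_quarter I) \<subseteq> enlarge I"
    by (auto simp: left_quarter_def right_quarter_def enlarge_def field_simps)
qed

lemma enlarge_mono:
  assumes "closed_interval I" "closed_interval J" "I \<subseteq> J"
  shows "enlarge I \<subseteq> enlarge J"
proof -
  obtain l u where lu: "l < u" "I = {l..u}"
    using assms(1) by (auto simp: closed_interval_def)
  obtain l' u' where lu': "l' < u'" "J = {l'..u'}"
    using assms(2) by (auto simp: closed_interval_def)
  have "l' \<le> l" "u \<le> u'" using assms(3) lu lu' by auto
  then show ?thesis using lu lu' by (auto simp: enlarge_def)
qed

lemma dist_outside_enlarge:
  assumes "closed_interval I" "x \<in> I" "y \<notin> enlarge I"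
  shows "measure lborel I \<le> \<bar>x - y\<bar>"
  using assms by (auto simp: enlarge_def closed_interval_def)

lemma threat_map_upt:
  "threat X (map B [0..<Suc n]) U =
     (\<Sum>i\<le>n. (3/2) ^ (n - i) * real (card (X (map B [0..<Suc i]) \<inter> U)))"
proof -
  have "take (Suc i) (map B [0..<Suc n]) = map B [0..<Suc i]" if "i \<le> n" for i
    using that by (simp only: take_map take_upt) (simp add: take_upt)
  then show ?thesis
    unfolding threat_def by (intro sum.cong) auto
qed

lemma threat_Suc:
  "threat X (map B [0..<Suc (Suc n)]) U =
     3/2 * threat X (map B [0..<Suc n]) U + real (card (X (map B [0..<Suc (Suc n)]) \<inter> U))"
proof -
  have "(\<Sum>i\<le>n. (3/2) ^ (Suc n - i) * real (card (X (map B [0..<Suc i]) \<inter> U)))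
      = 3/2 * (\<Sum>i\<le>n. (3/2) ^ (n - i) * real (card (X (map B [0..<Suc i]) \<inter> U)))"
    unfolding sum_distrib_left by (intro sum.cong) (auto simp: Suc_diff_le)
  then show ?thesis unfolding threat_map_upt by simp
qed

lemma threat_disjoint_union:
  assumes "\<And>n. finite (X (map B [0..<Suc n]))" "U \<inter> V = {}" "U \<union> V \<subseteq> Z"
  shows "threat X (map B [0..<Suc n]) U + threat X (map B [0..<Suc n]) V
           \<le> threat X (map B [0..<Suc n]) Z"
proof -
  have "card (S \<inter> U) + card (S \<inter> V) \<le> card (S \<inter> Z)" if "finite S" for S
  proof -
    have "card (S \<inter> U) + card (S \<inter> V) = card (S \<inter> U \<union> S \<inter> V)"
      using that assms(2) by (subst card_Un_disjoint) auto
    also have "\<dots> \<le> card (S \<inter> Z)"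
      using that assms(3) by (intro card_mono) auto
    finally show ?thesis .
  qed
  from this[OF assms(1)] show ?thesis
    unfolding threat_map_upt sum.distrib[symmetric] distrib_left[symmetric]
    by (intro sum_mono mult_left_mono) (simp_all flip: of_nat_add)
qed

text \<open>
  Each move halves the threat, ageing multiplies it by 3/2 and the new targets add at most \<open>Q\<close>, so
  the threat stays below \<open>2 Q\<close>. A target of age \<open>n\<close> that is still threatened contributes
  \<open>(3/2) ^ n\<close>; hence targets are shaken off within a bounded number of rounds.
\<close>

lemma quarter_strategy_avoids:
  assumes W: "\<And>n. W n = quarter_strategy X (map B [0..<Suc n])"
    and legal: "\<And>n. legal2 \<gamma> B W n"
    and fin: "\<And>n. finite (X (map B [0..<Suc n]))"
    and card: "\<And>n. card (X (map B [0..<Suc n])) \<le> Q"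
  obtains A where "\<And>i x y. y \<in> X (map B [0..<Suc i]) \<Longrightarrow> x \<in> W (i + A) \<Longrightarrow>
      measure lborel (W (i + A)) \<le> \<bar>x - y\<bar>"
proof -
  have B: "closed_interval (B n)" for n using legal[of n] by (simp add: legal2_def)
  have quarter: "W n = left_quarter (B n) \<or> W n = right_quarter (B n)" for n
    using quarter_strategy_cases[of X "map B [0..<Suc n]"] unfolding W by simp
  note ci = quarter_legal(1)[OF B quarter]
  have BW: "B (Suc n) \<subseteq> W n" for n using legal[of "Suc n"] by (simp add: legal2_def)
  define t where "t n Z = threat X (map B [0..<Suc n]) Z" for n Z
  \<comment> \<open>The chosen quarter has the smaller of two threats whose sum is at most the
    threat of the enlarged \<open>B n\<close>.\<close>
  have half: "2 * t n (enlarge (W n)) \<le> t n (enlarge (B n))" for n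
  proof -
    have "t n (enlarge (W n)) \<le> t n (enlarge (left_quarter (B n)))"
      "t n (enlarge (W n)) \<le> t n (enlarge (right_quarter (B n)))"
      unfolding W quarter_strategy_def t_def by auto
    moreover have "t n (enlarge (left_quarter (B n))) + t n (enlarge (right_quarter (B n)))
        \<le> t n (enlarge (B n))"
      unfolding t_def by (intro threat_disjoint_union fin enlarge_quarters B)
    ultimately show ?thesis by linarith
  qed
  have new: "real (card (X (map B [0..<Suc n]) \<inter> U)) \<le> Q" for n U
    using card_mono[OF fin Int_lower1] card order_trans by (metis of_nat_le_iff)
  have mono: "t n U \<le> t n V" if "U \<subseteq> V" for n U V
    unfolding t_def threat_map_upt using that fin
    by (intro sum_mono mult_left_mono) (auto intro!: card_mono)
  have bound: "t n (enlarge (W n)) \<le> 2 * Q" for n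
  proof (induction n)
    case 0
    have "t 0 (enlarge (W 0)) = real (card (X (map B [0..<Suc 0]) \<inter> enlarge (W 0)))"
      unfolding t_def threat_map_upt by simp
    then show ?case using new[of 0 "enlarge (W 0)"] by linarith
  next
    case (Suc n)
    have "2 * t (Suc n) (enlarge (W (Suc n))) \<le> t (Suc n) (enlarge (W n))"
      using half mono enlarge_mono[OF B ci BW] order_trans by blast
    also have "\<dots> \<le> 3/2 * t n (enlarge (W n)) + Q"
      unfolding t_def threat_Suc using new by (simp del: upt_Suc)
    finally show ?case using Suc by linarith
  qed
  \<comment> \<open>A single target of age \<open>A\<close> would already exceed the bound on the
    threat. The delay depends on \<open>Q\<close> only.\<close>
  obtain A where A: "2 * real Q < (3/2) ^ A"
    using real_arch_pow[of "3/2"] by auto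
  have "y \<notin> enlarge (W (i + A))" if "y \<in> X (map B [0..<Suc i])" for i y
  proof
    assume "y \<in> enlarge (W (i + A))"
    then have "card (X (map B [0..<Suc i]) \<inter> enlarge (W (i + A))) \<noteq> 0"
      using that fin[of i] by (simp only: card_eq_0_iff) blast
    then have "(3/2) ^ A * 1 \<le> (3/2 :: real) ^ (i + A - i) *
        real (card (X (map B [0..<Suc i]) \<inter> enlarge (W (i + A))))"
      by (intro mult_mono) auto
    also have "\<dots> \<le> t (i + A) (enlarge (W (i + A)))"
      unfolding t_def threat_map_upt
      by (rule member_le_sum[where f = "\<lambda>j. (3/2) ^ (i + A - j) *
        real (card (X (map B [0..<Suc j]) \<inter> enlarge (W (i + A))))"]) auto
    also have "\<dots> \<le> 2 * Q" by (rule bound)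
    finally show False using A by simp
  qed
  then show ?thesis using that dist_outside_enlarge[OF ci] by blast
qed

section \<open>From boundedly many targets per round to winning sets\<close>

lemma legal_play_length:
  assumes "\<And>n. legal2 \<gamma> B W n" "\<And>n. legal1 a B W n"
  shows "measure lborel (B n) = (a * \<gamma>) ^ n * measure lborel (B 0)"
proof (induction n)
  case (Suc n)
  then show ?case using assms(1)[of "Suc n"] assms(2)[of n] by (simp add: legal2_def legal1_def)
qed simp

text \<open>Separates the game from the dynamics; \<open>good k \<delta> x\<close> will mean that
  \<open>(T ^^ k) x\<close> is at least \<delta> away from \<xi>. The targets of order
  \<open>k\<close> are issued in the first round whose interval is no longer than
  \<open>c / b ^ k\<close>. They are shaken off after a fixed delay, when the interval length is
  still comparable to \<open>1 / b ^ k\<close>.\<close>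

lemma parameter_winning_quarter:
  fixes b c :: real and good :: "nat \<Rightarrow> real \<Rightarrow> real \<Rightarrow> bool" and K :: nat
  assumes b: "1 < b" and c: "0 < c"
    and centres: "\<And>k l u. 0 \<le> l \<Longrightarrow> l < u \<Longrightarrow> u \<le> 1 \<Longrightarrow> (u - l) * b ^ k \<le> c \<Longrightarrow>
      \<exists>C. finite C \<and> card C \<le> K \<and>
        (\<forall>\<delta>>0. \<forall>x\<in>{l..u}. (\<forall>y\<in>C. \<delta> \<le> \<bar>x - y\<bar> * b ^ k) \<longrightarrow> good k \<delta> x)"
    and S: "\<And>x \<delta>. x \<in> {0..1} \<Longrightarrow> 0 < \<delta> \<Longrightarrow> (\<And>k. good k \<delta> x) \<Longrightarrow> x \<in> S"
  shows "parameter_winning (1/4) S"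
  unfolding parameter_winning_def
proof
  fix \<gamma> :: real assume \<gamma>: "\<gamma> \<in> {0<..<1}"
  define P where "P k I C \<longleftrightarrow> finite C \<and> card C \<le> K \<and>
        (\<forall>\<delta>>0. \<forall>x\<in>I. (\<forall>y\<in>C. \<delta> \<le> \<bar>x - y\<bar> * b ^ k) \<longrightarrow> good k \<delta> x)" for k I C
  \<comment> \<open>A strategy must be a function of the moves, so the targets are fixed once for
    every order and interval.\<close>
  define C where "C k I = (SOME C. P k I C)" for k I
  have C: "P k I (C k I)"
    if I: "closed_interval I" "I \<subseteq> {0..1}" "measure lborel I * b ^ k \<le> c" for k I
  proof -
    obtain l u where lu: "l < u" "I = {l..u}"
      using I(1) by (auto simp: closed_interval_def)
    then have "\<exists>C. P k I C"
      unfolding P_def lu(2) using I(2,3) lu by (intro centres) auto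
    then show ?thesis unfolding C_def by (rule someI_ex)
  qed
  define q where "q = \<gamma> / 4"
  have q: "0 < q" "q < 1" using \<gamma> by (auto simp: q_def)
  \<comment> \<open>The orders that become relevant in the latest round: one round shrinks lengths
    by \<open>q\<close>, so the lower bound says that the previous interval was still too long. The
    first round has no predecessor and takes all orders that fit.\<close>
  define ord where "ord bs = {k. measure lborel (last bs) * b ^ k \<le> c \<and>
      (length bs = 1 \<or> c * q < measure lborel (last bs) * b ^ k)}" for bs :: "real set list"
  define X where "X bs = (\<Union>k\<in>ord bs. C k (last bs))" for bs
  show "game_winning (1/4) \<gamma> S"
    unfolding game_winning_def
  proof (rule exI[of _ "quarter_strategy X"], intro allI impI conjI)
    fix B W :: "nat \<Rightarrow> real set" and n
    assume W: "\<forall>n. W n = quarter_strategy X (map B [0..<Suc n])"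
      and "\<forall>k\<le>n. legal2 \<gamma> B W k"
    then have "closed_interval (B n)" by (simp add: legal2_def)
    moreover have "W n = left_quarter (B n) \<or> W n = right_quarter (B n)"
      using quarter_strategy_cases[of X "map B [0..<Suc n]"] by (simp add: W)
    ultimately show "legal1 (1/4) B W n" by (rule legal1_quarter)
  next
    fix B W :: "nat \<Rightarrow> real set"
    assume W: "\<forall>n. W n = quarter_strategy X (map B [0..<Suc n])"
      and legal2: "\<forall>n. legal2 \<gamma> B W n"
    have B: "closed_interval (B n)" for n using legal2[rule_format, of n] by (simp add: legal2_def)
    have quarter: "W n = left_quarter (B n) \<or> W n = right_quarter (B n)" for n
      using quarter_strategy_cases[of X "map B [0..<Suc n]"] by (simp add: W)
    have legal1: "legal1 (1/4) B W n" for n using B quarter by (rule legal1_quarter)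
    have WB: "W n \<subseteq> B n" for n using legal1[of n] by (simp add: legal1_def)
    have B01: "B n \<subseteq> {0..1}" for n
    proof (induction n)
      case 0
      then show ?case using legal2[rule_format, of 0] by (simp add: legal2_def)
    next
      case (Suc n)
      then show ?case using legal2[rule_format, of "Suc n"] WB[of n] by (auto simp: legal2_def)
    qed
    define r where "r = measure lborel (B 0)"
    have r: "0 < r" using B[of 0] by (auto simp: r_def closed_interval_def)
    have len: "measure lborel (B n) = q ^ n * r" for n
      using legal_play_length[of \<gamma> B W "1/4" n] legal2 legal1 by (simp add: q_def r_def)
    have ord: "ord (map B [0..<Suc n]) =
        {k. q ^ n * r * b ^ k \<le> c \<and> (n = 0 \<or> c * q < q ^ n * r * b ^ k)}" for n
      by (auto simp: ord_def len)
    \<comment> \<open>In round 0 the orders satisfy \<open>b ^ k \<le> c / r\<close>; in a later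
      round the powers \<open>b ^ k\<close> differ by a factor below \<open>1 / q\<close>. The bound
      depends on the play through \<open>r\<close>, which is harmless because the strategy does not
      mention it.\<close>
    obtain N0 where N0: "c / r < b ^ N0" using real_arch_pow[OF b] by blast
    obtain N1 where N1: "1 / q < b ^ N1" using real_arch_pow[OF b] by blast
    define N where "N = max N0 N1"
    have "b ^ N0 \<le> b ^ N" "b ^ N1 \<le> b ^ N"
      unfolding N_def using b by (simp_all add: power_increasing)
    with N0 N1 have N: "c / r < b ^ N" "1 / q < b ^ N" by simp_all
    have ord_sub: "\<exists>k0. ord (map B [0..<Suc n]) \<subseteq> {k0..<k0 + N}" for n
    proof (cases "ord (map B [0..<Suc n]) = {}")
      case False
      define k0 where "k0 = (LEAST k. k \<in> ord (map B [0..<Suc n]))"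
      have "\<exists>k. k \<in> ord (map B [0..<Suc n])" using False by blast
      then have k0: "k0 \<in> ord (map B [0..<Suc n])" unfolding k0_def by (rule LeastI_ex)
      have "k < k0 + N" if k: "k \<in> ord (map B [0..<Suc n])" for k
      proof (rule ccontr)
        assume "\<not> k < k0 + N"
        then have ge: "b ^ (k0 + N) \<le> b ^ k" using b by (intro power_increasing) auto
        show False
        proof (cases "n = 0")
          case True
          have "b ^ k \<le> c / r" using k r True unfolding ord by (simp add: field_simps)
          moreover have "b ^ N \<le> b ^ (k0 + N)" using b by (intro power_increasing) auto
          ultimately show False using ge N by simp
        next
          case False
          have pos: "0 < q ^ n * r" using q r by simp
          have "c * q < q ^ n * r * b ^ k0" using k0 False unfolding ord by simp
          then have "c < q ^ n * r * b ^ k0 * (1 / q)" using q by (simp add: field_simps)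
          also have "\<dots> \<le> q ^ n * r * b ^ k0 * b ^ N"
            using N(2) pos b by (intro mult_left_mono) auto
          also have "\<dots> \<le> q ^ n * r * b ^ k"
            using ge pos unfolding mult.assoc[of "q ^ n * r"] power_add[symmetric]
            by (intro mult_left_mono) auto
          finally show False using k unfolding ord by simp
        qed
      qed
      moreover have "k0 \<le> k" if "k \<in> ord (map B [0..<Suc n])" for k
        unfolding k0_def using that by (rule Least_le)
      ultimately show ?thesis by (intro exI[of _ k0]) auto
    qed simp
    have ordC: "P k (B n) (C k (B n))" if "k \<in> ord (map B [0..<Suc n])" for k n
      using that B B01 by (intro C) (auto simp: ord_def)
    have X: "X (map B [0..<Suc n]) = (\<Union>k\<in>ord (map B [0..<Suc n]). C k (B n))" for n
      by (simp add: X_def)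
    have fin_ord: "finite (ord (map B [0..<Suc n]))" for n
      using ord_sub finite_subset by blast
    have fin: "finite (X (map B [0..<Suc n]))" for n
      unfolding X using fin_ord ordC by (auto simp: P_def)
    have card: "card (X (map B [0..<Suc n])) \<le> N * K" for n
    proof -
      obtain k0 where "ord (map B [0..<Suc n]) \<subseteq> {k0..<k0 + N}" using ord_sub by blast
      then have "card (ord (map B [0..<Suc n])) \<le> N"
        using card_mono[of "{k0..<k0 + N}"] by fastforce
      have "card (X (map B [0..<Suc n])) \<le> (\<Sum>k\<in>ord (map B [0..<Suc n]). card (C k (B n)))"
        unfolding X by (rule card_UN_le[OF fin_ord])
      also have "\<dots> \<le> (\<Sum>k\<in>ord (map B [0..<Suc n]). K)"
        using ordC by (intro sum_mono) (auto simp: P_def)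
      also have "\<dots> \<le> N * K" using \<open>card (ord _) \<le> N\<close> by simp
      finally show ?thesis .
    qed
    obtain A where A: "\<And>i x y. y \<in> X (map B [0..<Suc i]) \<Longrightarrow> x \<in> W (i + A) \<Longrightarrow>
      measure lborel (W (i + A)) \<le> \<bar>x - y\<bar>"
      using quarter_strategy_avoids[of W X B \<gamma> "N * K"] W legal2 fin card by blast
    \<comment> \<open>Chosen as a lower bound for the length of \<open>W (i + A)\<close> times
      \<open>b ^ k\<close>, where \<open>i\<close> is the round that issues order \<open>k\<close>:
      \<open>q ^ i * r * b ^ k\<close> is at least \<open>r\<close> if \<open>i = 0\<close> and
      exceeds \<open>c * q\<close> otherwise.\<close>
    define \<delta> where "\<delta> = q ^ A / 4 * min r (c * q)"
    have \<delta>: "0 < \<delta>" using q r c by (simp add: \<delta>_def)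
    show "(\<Inter>n. W n) \<subseteq> S"
    proof
      fix x assume x: "x \<in> (\<Inter>n. W n)"
      then have xB: "x \<in> B n" for n using WB by blast
      show "x \<in> S"
      proof (rule S[OF _ \<delta>])
        show "x \<in> {0..1}" using xB B01 by blast
        fix k
        have "\<exists>n. q ^ n * r * b ^ k \<le> c"
        proof -
          have "0 < c / (r * b ^ k)" using c r b by simp
          then obtain n where "q ^ n < c / (r * b ^ k)" using real_arch_pow_inv q(2) by blast
          then show ?thesis using r b by (intro exI[of _ n]) (simp add: field_simps)
        qed
        \<comment> \<open>The round that issues the targets of order \<open>k\<close>; its
          minimality supplies the lower bound in \<open>ord\<close>.\<close>
        define i where "i = (LEAST n. q ^ n * r * b ^ k \<le> c)"
        have i: "q ^ i * r * b ^ k \<le> c"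
          unfolding i_def using \<open>\<exists>n. q ^ n * r * b ^ k \<le> c\<close> by (rule LeastI_ex)
        have prev: "c * q < q ^ i * r * b ^ k" if "i \<noteq> 0"
        proof -
          obtain j where j: "i = Suc j" using \<open>i \<noteq> 0\<close> not0_implies_Suc by blast
          then have "j < i" by simp
          then have "\<not> q ^ j * r * b ^ k \<le> c" unfolding i_def by (rule not_less_Least)
          then show ?thesis using j q by (simp add: field_simps)
        qed
        have kord: "k \<in> ord (map B [0..<Suc i])" unfolding ord using i prev by auto
        have b1: "1 \<le> b ^ k" using b by (intro one_le_power) simp
        have "min r (c * q) \<le> q ^ i * r * b ^ k"
        proof (cases "i = 0")
          case True
          then show ?thesis using mult_left_mono[OF b1, of r] r by (simp add: min_le_iff_disj)
        qed (use prev in simp)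
        then have "q ^ A / 4 * min r (c * q) \<le> q ^ A / 4 * (q ^ i * r * b ^ k)"
          using q by (intro mult_left_mono) auto
        then have \<delta>_le: "\<delta> \<le> measure lborel (W (i + A)) * b ^ k"
          using legal1[of "i + A"] by (simp add: \<delta>_def legal1_def len power_add mult_ac)
        have "\<delta> \<le> \<bar>x - y\<bar> * b ^ k" if "y \<in> C k (B i)" for y
        proof -
          have "measure lborel (W (i + A)) \<le> \<bar>x - y\<bar>"
            using that kord x by (intro A) (auto simp: X simp del: upt_Suc)
          then have "measure lborel (W (i + A)) * b ^ k \<le> \<bar>x - y\<bar> * b ^ k"
            using b1 by (intro mult_right_mono) auto
          then show ?thesis using \<delta>_le by linarith
        qed
        then show "good k \<delta> x" using ordC[OF kord] \<delta> xB by (auto simp: P_def)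
      qed
    qed
  qed
qed

section \<open>Orbits of the critical point for shifts of finite type\<close>

text \<open>
  In a shift with forbidden words of length at most \<open>m\<close> the possible continuations of a prefix of
  length at least \<open>m\<close> depend only on its last \<open>m\<close> letters. Every tail of a lexicographically extremal
  sequence is the extremal continuation of the preceding prefix, so there are finitely many tails.
\<close>

lemma finite_tails_of_extremal:
  fixes \<omega> :: "nat \<Rightarrow> nat" and R :: "nat \<Rightarrow> nat \<Rightarrow> bool"
  assumes "finite_type \<Omega>" "\<omega> \<in> \<Omega>"
    and asym: "\<And>a b. R a b \<Longrightarrow> \<not> R b a"
    and ext: "\<And>\<rho> n. \<rho> \<in> \<Omega> \<Longrightarrow> (\<And>i. i < n \<Longrightarrow> \<rho> i = \<omega> i) \<Longrightarrow> \<rho> n \<noteq> \<omega> n \<Longrightarrow> R (\<omega> n) (\<rho> n)"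
  shows "finite (range (\<lambda>n i. \<omega> (n + i)))"
proof -
  obtain F where F: "finite F" and
    \<Omega>: "\<Omega> = {\<omega>. range \<omega> \<subseteq> {0, 1} \<and> (\<forall>w\<in>F. \<not> occurs_in w \<omega>)}"
    using assms(1) by (auto simp: finite_type_def)
  define m where "m = Max (insert 0 (length ` F))"
  have m: "length w \<le> m" if "w \<in> F" for w
    unfolding m_def using F that by (intro Max_ge) auto
  define key where "key n = map \<omega> [n - m..<n]" for n
  \<comment> \<open>The tail at \<open>n'\<close> may be replaced by the tail at \<open>n\<close>: a
    forbidden word in the result has at most \<open>m\<close> letters, so it lies before
    \<open>n'\<close> or starts at \<open>n' - m\<close> or later. Either way it already occurs in
    \<omega>, in the second case shifted by \<open>n - n'\<close>.\<close>
  have splice: "(\<lambda>i. if i < n' then \<omega> i else \<omega> (i - n' + n)) \<in> \<Omega>"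
    if n: "m \<le> n" "m \<le> n'" "key n = key n'" for n n'
  proof -
    have eq: "\<omega> (n' - j) = \<omega> (n - j)" if "0 < j" "j \<le> m" for j
    proof -
      have "key n ! (m - j) = \<omega> (n - j)" "key n' ! (m - j) = \<omega> (n' - j)"
        using n(1,2) that by (simp_all add: key_def)
      with n(3) show ?thesis by simp
    qed
    let ?\<rho> = "\<lambda>i. if i < n' then \<omega> i else \<omega> (i - n' + n)"
    have "occurs_in w \<omega>" if w: "w \<in> F" "occurs_in w ?\<rho>" for w
    proof -
      obtain k where k: "\<And>i. i < length w \<Longrightarrow> ?\<rho> (k + i) = w ! i"
        using w(2) by (auto simp: occurs_in_def)
      show ?thesis
      proof (cases "k + length w \<le> n'")
        case True
        have "\<omega> (k + i) = w ! i" if "i < length w" for i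
          using k[OF that] True that by simp
        then show ?thesis by (auto simp: occurs_in_def)
      next
        case False
        have km: "n' \<le> k + m" using False m[OF w(1)] by linarith
        have "\<omega> (k + n - n' + i) = w ! i" if "i < length w" for i
        proof (cases "k + i < n'")
          case True
          have "\<omega> (n' - (n' - (k + i))) = \<omega> (n - (n' - (k + i)))"
            using True km by (intro eq) auto
          moreover have "n - (n' - (k + i)) = k + n - n' + i" using True km n by linarith
          ultimately show ?thesis using k[OF that] True by simp
        next
          case False
          then have "k + i - n' + n = k + n - n' + i" using km n by linarith
          with k[OF that] False show ?thesis by simp
        qed
        then show ?thesis by (auto simp: occurs_in_def)
      qed
    qed
    moreover have "\<omega> i \<in> {0, 1}" for i
      using assms(2) unfolding \<Omega> by blast
    then have "range ?\<rho> \<subseteq> {0, 1}" by (simp add: image_subset_iff)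
    moreover have "\<forall>w\<in>F. \<not> occurs_in w \<omega>" using assms(2) unfolding \<Omega> by blast
    ultimately show ?thesis unfolding \<Omega> by blast
  qed
  have step: "R (\<omega> (n' + i)) (\<omega> (n + i))"
    if "m \<le> n" "m \<le> n'" "key n = key n'" "\<And>j. j < i \<Longrightarrow> \<omega> (n + j) = \<omega> (n' + j)"
      "\<omega> (n + i) \<noteq> \<omega> (n' + i)" for n n' i
  proof -
    have agree: "(if l < n' then \<omega> l else \<omega> (l - n' + n)) = \<omega> l" if "l < n' + i" for l
    proof (cases "l < n'")
      case False
      then have "l - n' < i" using that by linarith
      from \<open>\<And>j. j < i \<Longrightarrow> \<omega> (n + j) = \<omega> (n' + j)\<close>[OF this] False show ?thesis
        by (simp add: add.commute)
    qed simp
    show ?thesis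
      using ext[OF splice[OF that(1-3)], of "n' + i"] agree that(5) by (simp add: add.commute)
  qed
  have tails: "(\<lambda>i. \<omega> (n + i)) = (\<lambda>i. \<omega> (n' + i))"
    if n: "m \<le> n" "m \<le> n'" "key n = key n'" for n n'
  proof (rule ccontr)
    assume "(\<lambda>i. \<omega> (n + i)) \<noteq> (\<lambda>i. \<omega> (n' + i))"
    then have ex: "\<exists>i. \<omega> (n + i) \<noteq> \<omega> (n' + i)" by auto
    define i where "i = (LEAST i. \<omega> (n + i) \<noteq> \<omega> (n' + i))"
    have i: "\<omega> (n + i) \<noteq> \<omega> (n' + i)" using ex unfolding i_def by (rule LeastI_ex)
    have less: "\<omega> (n + j) = \<omega> (n' + j)" if "j < i" for j
      using not_less_Least[OF that[unfolded i_def]] by simp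
    \<comment> \<open>At the first difference, extremality against the two splices, with
      \<open>n\<close> and \<open>n'\<close> interchanged, orders the same two letters both
      ways.\<close>
    show False
      using asym step[OF n less i] step[OF n(2,1) n(3)[symmetric] less[symmetric] i[symmetric]]
      by blast
  qed
  have digits: "\<omega> i \<in> {0, 1}" for i using assms(2) unfolding \<Omega> by blast
  have "key ` {m..} \<subseteq> {xs. set xs \<subseteq> {0, 1} \<and> length xs = m}"
    unfolding key_def using digits by (simp add: image_subset_iff)
  then have "finite (key ` {m..})"
    by (rule finite_subset) (intro finite_lists_length_eq, simp)
  \<comment> \<open>One representative position for each of the finitely many keys accounts for all
    tails from \<open>m\<close> on.\<close>
  moreover have "(\<lambda>i. \<omega> (n + i)) = (\<lambda>i. \<omega> (inv_into {m..} key (key n) + i))" if "m \<le> n" for n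
    using that inv_into_into[of "key n" key "{m..}"] f_inv_into_f[of "key n" key "{m..}"]
    by (intro tails) auto
  then have "(\<lambda>n i. \<omega> (n + i)) ` {m..} \<subseteq>
      (\<lambda>w i. \<omega> (inv_into {m..} key w + i)) ` (key ` {m..})"
    by blast
  ultimately have "finite ((\<lambda>n i. \<omega> (n + i)) ` {m..})"
    using finite_subset by blast
  moreover have "range (\<lambda>n i. \<omega> (n + i)) =
      (\<lambda>n i. \<omega> (n + i)) ` {..<m} \<union> (\<lambda>n i. \<omega> (n + i)) ` {m..}"
    unfolding image_Un[symmetric] by (rule arg_cong[where f = "image _"]) auto
  ultimately show ?thesis by simp
qed

section \<open>Orbits determined by their itineraries\<close>

lemma expanding_funpow_diff:
  fixes f :: "real \<Rightarrow> real"
  assumes "\<And>x. x \<in> A \<Longrightarrow> f x \<in> A"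
    and "\<And>x y. x \<in> A \<Longrightarrow> y \<in> A \<Longrightarrow> P x = P y \<Longrightarrow> f y - f x = \<beta> * (y - x)"
    and "x \<in> A" "y \<in> A" "\<And>i. i < n \<Longrightarrow> P ((f ^^ i) x) = P ((f ^^ i) y)"
  shows "(f ^^ n) y - (f ^^ n) x = \<beta> ^ n * (y - x)"
proof -
  have A: "(f ^^ n) z \<in> A" if "z \<in> A" for z n
    using that assms(1) by (induction n) auto
  show ?thesis
    using assms(5)
  proof (induction n)
    case (Suc n)
    then show ?case
      using assms(2)[OF A A, OF assms(3,4), of n n] by simp
  qed simp
qed

text \<open>Points with equal itineraries separate by the factor \<open>\<beta> ^ n\<close> while
  staying in the unit interval, so they coincide. Hence an orbit has as many points as it has
  shifted itineraries.\<close>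

lemma finite_orbit_of_finite_itineraries:
  fixes f :: "real \<Rightarrow> real"
  assumes "1 < \<beta>" "A \<subseteq> {0..1}" "\<And>x. x \<in> A \<Longrightarrow> f x \<in> A"
    and "\<And>x y. x \<in> A \<Longrightarrow> y \<in> A \<Longrightarrow> P x = P y \<Longrightarrow> f y - f x = \<beta> * (y - x)"
    and "z \<in> A" "finite (range (\<lambda>n i. P ((f ^^ (n + i)) z)))"
  shows "finite (range (\<lambda>n. (f ^^ n) z))"
proof -
  have A: "(f ^^ n) x \<in> A" if "x \<in> A" for x n
    using that assms(3) by (induction n) auto
  define code where "code x = (\<lambda>i. P ((f ^^ i) x))" for x
  have "inj_on code A"
  proof
    fix x y assume xy: "x \<in> A" "y \<in> A" "code x = code y"
    then have "P ((f ^^ i) x) = P ((f ^^ i) y)" for i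
      unfolding code_def by meson
    then have diff: "(f ^^ n) y - (f ^^ n) x = \<beta> ^ n * (y - x)" for n
      using assms(3,4) xy(1,2) by (intro expanding_funpow_diff[where P = P]) auto
    have bound: "\<beta> ^ n * \<bar>y - x\<bar> \<le> 1" for n
    proof -
      have "\<beta> ^ n * \<bar>y - x\<bar> = \<bar>(f ^^ n) y - (f ^^ n) x\<bar>"
        using assms(1) unfolding diff by (simp add: abs_mult)
      also have "\<dots> \<le> 1"
        using A[OF xy(1), of n, THEN subsetD[OF assms(2)]] A[OF xy(2), of n, THEN subsetD[OF assms(2)]]
        by (simp add: abs_le_iff)
      finally show ?thesis .
    qed
    show "x = y"
    proof (rule ccontr)
      assume "x \<noteq> y"
      moreover obtain n where "1 / \<bar>y - x\<bar> < \<beta> ^ n"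
        using real_arch_pow[OF assms(1)] by blast
      ultimately show False using bound[of n] by (simp add: field_simps)
    qed
  qed
  moreover have "code ` range (\<lambda>n. (f ^^ n) z) = range (\<lambda>n i. P ((f ^^ (n + i)) z))"
  proof -
    have "(f ^^ i) ((f ^^ n) z) = (f ^^ (n + i)) z" for n i
      by (simp add: funpow_add[symmetric, THEN fun_cong, unfolded o_apply] add.commute)
    then show ?thesis by (simp add: image_image code_def)
  qed
  ultimately show ?thesis
    using assms(6) A[OF assms(5)] by (metis (no_types, lifting) finite_imageD image_subsetI inj_on_subset)
qed

section \<open>The transformation and its critical orbits\<close>

text \<open>The left-continuous version of the transformation on the unit interval: the critical
  point goes to 1 instead of 0.\<close>

definition lower_map :: "real \<Rightarrow> real \<Rightarrow> real \<Rightarrow> real" where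
  "lower_map \<beta> \<alpha> x = (if x \<le> crit_point \<beta> \<alpha> then \<beta> * x + \<alpha> else \<beta> * x + \<alpha> - 1)"

locale intermediate_beta =
  fixes \<beta> \<alpha> :: real
  assumes params: "(\<beta>, \<alpha>) \<in> param_region"
begin

abbreviation "T \<equiv> beta_map \<beta> \<alpha>"
abbreviation "T' \<equiv> lower_map \<beta> \<alpha>"
abbreviation "p \<equiv> crit_point \<beta> \<alpha>"

lemma beta_bounds: "1 < \<beta>" "0 \<le> \<alpha>" "\<alpha> + \<beta> \<le> 2"
  using params by (auto simp: param_region_def)

lemma beta_crit: "\<beta> * p = 1 - \<alpha>"
  using beta_bounds by (simp add: crit_point_def)

lemma beta_less_crit_iff: "x < p \<longleftrightarrow> \<beta> * x + \<alpha> < 1"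
  using beta_bounds by (simp add: crit_point_def field_simps)

lemma beta_map_less: "0 \<le> x \<Longrightarrow> x < p \<Longrightarrow> T x = \<beta> * x + \<alpha>"
  using beta_bounds unfolding beta_less_crit_iff beta_map_def
  by (simp add: frac_eq)

lemma beta_map_ge:
  assumes "p \<le> x" "x < 1"
  shows "T x = \<beta> * x + \<alpha> - 1"
proof -
  have "\<beta> * x < \<beta> * 1" using assms beta_bounds by (intro mult_strict_left_mono) auto
  moreover have "1 \<le> \<beta> * x + \<alpha>" using assms(1) beta_less_crit_iff[of x] by linarith
  ultimately have "\<lfloor>\<beta> * x + \<alpha>\<rfloor> = 1" using beta_bounds(3) by (intro floor_unique) simp_all
  then show ?thesis by (simp add: beta_map_def frac_def)
qed

lemma beta_map_range: "T x \<in> {0..<1}"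
  by (simp add: beta_map_def frac_lt_1)

lemma beta_orbit_range: "x \<in> {0..<1} \<Longrightarrow> (T ^^ n) x \<in> {0..<1}"
  using beta_map_range by (cases n) (simp_all del: atLeastLessThan_iff)

lemma beta_map_diff:
  assumes "x \<in> {0..<1}" "y \<in> {0..<1}" "x < p \<longleftrightarrow> y < p"
  shows "T y - T x = \<beta> * (y - x)"
  using assms beta_map_less[of x] beta_map_less[of y] beta_map_ge[of x] beta_map_ge[of y]
  by (cases "x < p") (simp_all add: algebra_simps not_less)

lemma lower_map_range:
  assumes "x \<in> {0..1}"
  shows "T' x \<in> {0..1}"
proof -
  have "0 \<le> \<beta> * x" "\<beta> * x \<le> \<beta> * 1" using assms beta_bounds by (auto simp: mult_left_le)
  moreover have "\<beta> * x + \<alpha> \<le> 1 \<longleftrightarrow> x \<le> p"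
    using beta_bounds by (simp add: crit_point_def field_simps)
  ultimately show ?thesis
    using beta_bounds(2,3) unfolding lower_map_def by (cases "x \<le> p") auto
qed

lemma lower_map_diff: "(x \<le> p \<longleftrightarrow> y \<le> p) \<Longrightarrow> T' y - T' x = \<beta> * (y - x)"
  by (auto simp: lower_map_def algebra_simps)

section \<open>Lexicographic extremality of the expansions of 0 and 1\<close>

lemma upper_expansion_mono_at_first_difference:
  assumes "x \<in> {0..<1}" "y \<in> {0..<1}" "x \<le> y"
    and "\<And>i. i < n \<Longrightarrow> upper_expansion \<beta> \<alpha> x i = upper_expansion \<beta> \<alpha> y i"
  shows "upper_expansion \<beta> \<alpha> x n \<le> upper_expansion \<beta> \<alpha> y n"
proof -
  \<comment> \<open>Equal letters mean the same increasing branch, so the order of the iterates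
    survives up to the first difference.\<close>
  have "((T ^^ i) x < p) = ((T ^^ i) y < p)" if "i < n" for i
    using assms(4)[OF that] by (auto simp: upper_expansion_def split: if_splits)
  then have "(T ^^ n) y - (T ^^ n) x = \<beta> ^ n * (y - x)"
    using assms(1,2) beta_map_range beta_map_diff
    by (intro expanding_funpow_diff[where A = "{0..<1}" and P = "\<lambda>x. x < p"]) blast+
  moreover have "0 \<le> \<beta> ^ n * (y - x)" using assms(3) beta_bounds by simp
  ultimately show ?thesis by (auto simp: upper_expansion_def)
qed

lemma eventually_upper_expansion_eq_lower:
  "\<forall>\<^sub>F y in at_left x. \<forall>i\<le>n. upper_expansion \<beta> \<alpha> y i = lower_expansion \<beta> \<alpha> x i"
proof -
  have "\<forall>\<^sub>F y in at_left x. upper_expansion \<beta> \<alpha> y i = lower_expansion \<beta> \<alpha> x i" for i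
  proof -
    have "open ((\<lambda>f :: nat \<Rightarrow> nat. f i) -` {lower_expansion \<beta> \<alpha> x i})"
      by (intro open_vimage continuous_on_product_coordinates open_discrete)
    then show ?thesis
      using topological_tendstoD[OF tendsto_lower_expansion[of \<beta> \<alpha> x]] beta_bounds by fastforce
  qed
  then have "\<forall>\<^sub>F y in at_left x. \<forall>i\<in>{..n}. upper_expansion \<beta> \<alpha> y i = lower_expansion \<beta> \<alpha> x i"
    by (intro eventually_ball_finite ballI) auto
  then show ?thesis by (simp only: Ball_def atMost_iff)
qed

text \<open>Reduces comparisons of finite prefixes to upper expansions: a prefix of a lower
  expansion at \<open>x\<close> is read off slightly to the left of \<open>x\<close>.\<close>

lemma shift_prefix_upper_expansion:
  assumes "\<omega> \<in> intermediate_beta_shift \<beta> \<alpha>"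
  obtains x where "x \<in> {0..<1}" "\<And>i. i \<le> n \<Longrightarrow> upper_expansion \<beta> \<alpha> x i = \<omega> i"
proof -
  consider x where "x \<in> {0..<1}" "\<omega> = upper_expansion \<beta> \<alpha> x"
    | x where "x \<in> {0<..1}" "\<omega> = lower_expansion \<beta> \<alpha> x"
    using assms by (auto simp: intermediate_beta_shift_def)
  then show ?thesis
  proof cases
    case 1
    then show ?thesis using that by blast
  next
    case 2
    have "\<forall>\<^sub>F y in at_left x. y \<in> {0<..<x}"
      using 2 by (intro eventually_at_leftI[of 0]) auto
    with eventually_upper_expansion_eq_lower[of n x]
    have "\<forall>\<^sub>F y in at_left x. y \<in> {0..<1} \<and> (\<forall>i\<le>n. upper_expansion \<beta> \<alpha> y i = \<omega> i)"
      by eventually_elim (use 2 in auto)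
    then show ?thesis
      using that eventually_happens' trivial_limit_at_left_real by blast
  qed
qed

lemma upper_expansion_zero_minimal:
  assumes "\<omega> \<in> intermediate_beta_shift \<beta> \<alpha>"
    and "\<And>i. i < n \<Longrightarrow> \<omega> i = upper_expansion \<beta> \<alpha> 0 i"
  shows "upper_expansion \<beta> \<alpha> 0 n \<le> \<omega> n"
proof -
  obtain x where x: "x \<in> {0..<1}" "\<And>i. i \<le> n \<Longrightarrow> upper_expansion \<beta> \<alpha> x i = \<omega> i"
    using shift_prefix_upper_expansion[OF assms(1)] by blast
  have "upper_expansion \<beta> \<alpha> 0 n \<le> upper_expansion \<beta> \<alpha> x n"
    using x assms(2) by (intro upper_expansion_mono_at_first_difference) auto
  then show ?thesis using x(2) by simp
qed

lemma lower_expansion_one_maximal: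
  assumes "\<omega> \<in> intermediate_beta_shift \<beta> \<alpha>"
    and "\<And>i. i < n \<Longrightarrow> \<omega> i = lower_expansion \<beta> \<alpha> 1 i"
  shows "\<omega> n \<le> lower_expansion \<beta> \<alpha> 1 n"
proof -
  obtain x where x: "x \<in> {0..<1}" "\<And>i. i \<le> n \<Longrightarrow> upper_expansion \<beta> \<alpha> x i = \<omega> i"
    using shift_prefix_upper_expansion[OF assms(1)] by blast
  \<comment> \<open>Monotonicity covers only points below 1, so a point \<open>y\<close> between
    \<open>x\<close> and 1 with the right prefix stands in for 1.\<close>
  have "\<forall>\<^sub>F y in at_left 1. y \<in> {x<..<1}"
    using x by (intro eventually_at_leftI[of x]) auto
  from eventually_conj[OF this eventually_upper_expansion_eq_lower[of n 1]]
  obtain y where y: "y \<in> {x<..<1}" "\<And>i. i \<le> n \<Longrightarrow> upper_expansion \<beta> \<alpha> y i = lower_expansion \<beta> \<alpha> 1 i"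
    using eventually_happens' trivial_limit_at_left_real by blast
  have "upper_expansion \<beta> \<alpha> x n \<le> upper_expansion \<beta> \<alpha> y n"
    using x y assms(2) by (intro upper_expansion_mono_at_first_difference) auto
  then show ?thesis using x(2) y(2) by simp
qed

section \<open>The left-hand orbit of 1 and finiteness of both critical orbits\<close>

lemma beta_orbit_near_left_of_one:
  "\<forall>\<^sub>F y in at_left 1. (T ^^ n) y = (T' ^^ n) 1 - \<beta> ^ n * (1 - y)"
proof (induction n)
  case (Suc n)
  define e where "e = (T' ^^ n) 1"
  have lim: "((\<lambda>y. e - \<beta> ^ n * (1 - y)) \<longlongrightarrow> e - \<beta> ^ n * (1 - 1)) (at_left 1)"
    by (intro tendsto_intros)
  have below: "\<forall>\<^sub>F y in at_left (1::real). y \<in> {0<..<1}"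
    by (intro eventually_at_leftI[of 0]) auto
  \<comment> \<open>Points approaching \<open>e\<close> strictly from below end up below
    \<open>p\<close> even when \<open>e = p\<close>; this matches the convention
    \<open>x \<le> p\<close> in \<open>lower_map\<close>, so both maps use the same branch.\<close>
  have side: "\<forall>\<^sub>F y in at_left 1. e \<le> p \<longleftrightarrow> e - \<beta> ^ n * (1 - y) < p"
  proof (cases "e \<le> p")
    case True
    have "e - \<beta> ^ n * (1 - y) < p" if "y < 1" for y
    proof -
      have "0 < \<beta> ^ n * (1 - y)" using that beta_bounds by simp
      then show ?thesis using True by linarith
    qed
    then show ?thesis using True below by (auto elim: eventually_mono)
  next
    case False
    then have "\<forall>\<^sub>F y in at_left 1. p < e - \<beta> ^ n * (1 - y)"
      using lim by (intro order_tendstoD(1)[OF lim]) simp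
    then show ?thesis using False by (auto elim: eventually_mono)
  qed
  show ?case using Suc.IH below side
  proof eventually_elim
    case (elim y)
    define z where "z = (T ^^ n) y"
    have z: "z \<in> {0..<1}" using beta_orbit_range[of y n] elim(2) by (simp add: z_def)
    have z_eq: "z = e - \<beta> ^ n * (1 - y)" using elim(1) by (simp add: z_def e_def)
    have "T z = T' e - \<beta> * (\<beta> ^ n * (1 - y))"
    proof (cases "e \<le> p")
      case True
      then have "z < p" using elim(3) z_eq by simp
      then show ?thesis using True beta_map_less[of z] z
        by (simp add: lower_map_def z_eq algebra_simps)
    next
      case False
      then have "p \<le> z" using elim(3) z_eq by simp
      then show ?thesis using False beta_map_ge[of z] z
        by (simp add: lower_map_def z_eq algebra_simps)
    qed
    then show ?case by (simp add: z_def e_def mult.assoc)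
  qed
qed simp

lemma lower_expansion_one:
  "lower_expansion \<beta> \<alpha> 1 n = (if (T' ^^ n) 1 \<le> p then 0 else 1)"
proof -
  define e where "e = (T' ^^ n) 1"
  have lim: "((\<lambda>y. e - \<beta> ^ n * (1 - y)) \<longlongrightarrow> e - \<beta> ^ n * (1 - 1)) (at_left 1)"
    by (intro tendsto_intros)
  have "\<forall>\<^sub>F y in at_left (1::real). y \<in> {0<..<1}"
    by (intro eventually_at_leftI[of 0]) auto
  moreover have "\<forall>\<^sub>F y in at_left 1. p < e \<longrightarrow> p < e - \<beta> ^ n * (1 - y)"
    using order_tendstoD(1)[OF lim, of p] by (cases "p < e") auto
  ultimately have "\<forall>\<^sub>F y in at_left (1::real). lower_expansion \<beta> \<alpha> 1 n = (if e \<le> p then 0 else 1)"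
    using eventually_upper_expansion_eq_lower[of n 1] beta_orbit_near_left_of_one[of n]
  proof eventually_elim
    case (elim y)
    have "0 < \<beta> ^ n * (1 - y)" using elim(1) beta_bounds by simp
    then have "upper_expansion \<beta> \<alpha> y n = (if e \<le> p then 0 else 1)"
      using elim(2,4) by (auto simp: upper_expansion_def e_def)
    then show ?case using elim(3) by simp
  qed
  then show ?thesis unfolding e_def by simp
qed

text \<open>The upper expansion of 0 is the smallest and the lower expansion of 1 the largest
  sequence of the shift, so both have finitely many tails; these encode the itineraries of the two
  orbits.\<close>

lemma finite_orbits:
  assumes "finite_type (intermediate_beta_shift \<beta> \<alpha>)"
  shows "finite (range (\<lambda>n. (T ^^ n) 0))" "finite (range (\<lambda>n. (T' ^^ n) 1))"
proof -
  have "finite (range (\<lambda>n i. upper_expansion \<beta> \<alpha> 0 (n + i)))"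
    using assms
  proof (rule finite_tails_of_extremal[where R = "(<)"])
    show "upper_expansion \<beta> \<alpha> 0 \<in> intermediate_beta_shift \<beta> \<alpha>"
      by (simp add: intermediate_beta_shift_def)
    show "upper_expansion \<beta> \<alpha> 0 n < \<rho> n"
      if "\<rho> \<in> intermediate_beta_shift \<beta> \<alpha>" "\<And>i. i < n \<Longrightarrow> \<rho> i = upper_expansion \<beta> \<alpha> 0 i"
        "\<rho> n \<noteq> upper_expansion \<beta> \<alpha> 0 n" for \<rho> n
      using upper_expansion_zero_minimal[of \<rho> n] that by simp
  qed simp
  moreover have "finite (range (\<lambda>n i. lower_expansion \<beta> \<alpha> 1 (n + i)))"
    using assms
  proof (rule finite_tails_of_extremal[where R = "(>)"])
    show "lower_expansion \<beta> \<alpha> 1 \<in> intermediate_beta_shift \<beta> \<alpha>"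
      by (simp add: intermediate_beta_shift_def)
    show "\<rho> n < lower_expansion \<beta> \<alpha> 1 n"
      if "\<rho> \<in> intermediate_beta_shift \<beta> \<alpha>" "\<And>i. i < n \<Longrightarrow> \<rho> i = lower_expansion \<beta> \<alpha> 1 i"
        "\<rho> n \<noteq> lower_expansion \<beta> \<alpha> 1 n" for \<rho> n
      using lower_expansion_one_maximal[of \<rho> n] that by simp
  qed simp
  ultimately have "finite ((\<lambda>f i. f i = 0) ` range (\<lambda>n i. upper_expansion \<beta> \<alpha> 0 (n + i)))"
    "finite ((\<lambda>f i. f i = 0) ` range (\<lambda>n i. lower_expansion \<beta> \<alpha> 1 (n + i)))"
    by blast+
  moreover have digit: "(if P then 0 else 1 :: nat) = 0 \<longleftrightarrow> P" for P by simp
  ultimately have itineraries: "finite (range (\<lambda>n i. (T ^^ (n + i)) 0 < p))"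
    "finite (range (\<lambda>n i. (T' ^^ (n + i)) 1 \<le> p))"
    by (simp_all only: image_image upper_expansion_def lower_expansion_one digit)
  show "finite (range (\<lambda>n. (T ^^ n) 0))"
    using beta_bounds(1) _ beta_map_range beta_map_diff _ itineraries(1)
    by (rule finite_orbit_of_finite_itineraries[where P = "\<lambda>x. x < p" and A = "{0..<1}"]) auto
  show "finite (range (\<lambda>n. (T' ^^ n) 1))"
    using beta_bounds(1) _ lower_map_range lower_map_diff _ itineraries(2)
    by (rule finite_orbit_of_finite_itineraries[where P = "\<lambda>x. x \<le> p" and A = "{0..1}"]) auto
qed

section \<open>Affine branches of the iterates on short intervals\<close>

text \<open>
  If \<open>I\<close> is so short that \<open>\<beta> ^ k * |I|\<close> is below the distance from \<open>p\<close> to the finitely many other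
  points of the two critical orbits, then \<open>T ^^ k\<close> has at most one break in \<open>I\<close>: the pieces created by a
  break start at a point of the orbit of 0 or end at a point of the lower orbit of 1, and cannot
  straddle \<open>p\<close> as long as they are short.
\<close>

lemma beta_orbit_at_most_one_break:
  assumes gap0: "\<forall>n. (T ^^ n) 0 < p \<longrightarrow> (T ^^ n) 0 + c < p"
    and gap1: "\<forall>n. p < (T' ^^ n) 1 \<longrightarrow> p < (T' ^^ n) 1 - c"
    and I: "0 \<le> l" "l \<le> u" "u \<le> 1" "(u - l) * \<beta> ^ k \<le> c"
  shows "(\<exists>d. \<forall>x\<in>{l..u} - {1}. (T ^^ k) x = d + \<beta> ^ k * (x - l)) \<or>
    (\<exists>s\<in>{l..u}. \<exists>m n. \<forall>x\<in>{l..u} - {1}. (T ^^ k) x =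
      (if x < s then (T' ^^ m) 1 - \<beta> ^ k * (s - x) else (T ^^ n) 0 + \<beta> ^ k * (x - s)))"
  using I(4)
proof (induction k)
  case 0
  show ?case by (intro disjI1 exI[of _ l]) simp
next
  case (Suc k)
  have short: "(u - l) * \<beta> ^ k \<le> c"
  proof -
    have "(u - l) * \<beta> ^ k \<le> (u - l) * \<beta> ^ Suc k"
      using I beta_bounds by (intro mult_left_mono power_increasing) auto
    then show ?thesis using Suc.prems by linarith
  qed
  have bk: "0 < \<beta> ^ k" using beta_bounds by simp
  have range: "0 \<le> (T ^^ k) x" "(T ^^ k) x < 1" if "x \<in> {l..u} - {1}" for x
    using beta_orbit_range[of x k] that I by auto
  note low = beta_map_less[OF range(1)] and high = beta_map_ge[OF _ range(2)]
  from Suc.IH[OF short] show ?case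
  proof (elim disjE exE bexE)
    fix d assume d: "\<forall>x\<in>{l..u} - {1}. (T ^^ k) x = d + \<beta> ^ k * (x - l)"
    \<comment> \<open>The point where the line of the single branch crosses height \<open>p\<close>;
      it may lie outside the interval.\<close>
    define s where "s = l + (p - d) / \<beta> ^ k"
    have bs: "\<beta> ^ k * (s - l) = p - d" using bk beta_bounds by (simp add: s_def)
    have y: "(T ^^ k) x = p + \<beta> ^ k * (x - s)" if "x \<in> {l..u} - {1}" for x
    proof -
      have "(T ^^ k) x = d + \<beta> ^ k * (x - l)" using d that by blast
      then show ?thesis using bs by (simp add: algebra_simps)
    qed
    have bT: "\<beta> * (T ^^ k) x + \<alpha> = 1 + \<beta> ^ Suc k * (x - s)" if "x \<in> {l..u} - {1}" for x
      unfolding y[OF that] distrib_left beta_crit by simp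
    have less: "(T ^^ k) x < p \<longleftrightarrow> x < s" if "x \<in> {l..u} - {1}" for x
      unfolding y[OF that] using bk beta_bounds by (simp add: mult_less_0_iff)
    show ?thesis
    proof (cases "s \<in> {l..u}")
      case True
      \<comment> \<open>A break appears at \<open>s\<close>: the image of \<open>p\<close> is 1 from
        the left and 0 from the right, so both critical orbits start here with index 0.\<close>
      have "(T ^^ Suc k) x =
          (if x < s then (T' ^^ 0) 1 - \<beta> ^ Suc k * (s - x) else (T ^^ 0) 0 + \<beta> ^ Suc k * (x - s))"
        if x: "x \<in> {l..u} - {1}" for x
        using less[OF x] bT[OF x] low[OF x] high[OF _ x] by (cases "x < s") (auto simp: algebra_simps not_less)
      with True show ?thesis by blast
    next
      case False
      \<comment> \<open>The whole interval lies on one side of \<open>s\<close>; the integer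
        subtracted by \<open>T\<close> is 0 on the left and 1 on the right.\<close>
      define a where "a = (if u < s then 0 else - 1 :: real)"
      have "(T ^^ Suc k) x = 1 + a + \<beta> ^ Suc k * (l - s) + \<beta> ^ Suc k * (x - l)"
        if x: "x \<in> {l..u} - {1}" for x
      proof -
        have "x < s \<longleftrightarrow> u < s" using x False by auto
        then show ?thesis
          using less[OF x] bT[OF x] low[OF x] high[OF _ x]
          by (cases "x < s") (auto simp: algebra_simps not_less a_def)
      qed
      then show ?thesis by blast
    qed
  next
    fix s m n
    assume s: "s \<in> {l..u}" and eq: "\<forall>x\<in>{l..u} - {1}. (T ^^ k) x =
      (if x < s then (T' ^^ m) 1 - \<beta> ^ k * (s - x) else (T ^^ n) 0 + \<beta> ^ k * (x - s))"
    define d e where "d = (T ^^ n) 0" and "e = (T' ^^ m) 1"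
    have d: "0 \<le> d" "d < 1" using beta_orbit_range[of 0 n] by (auto simp: d_def)
    have "(T ^^ Suc k) x =
        (if x < s then (T' ^^ Suc m) 1 - \<beta> ^ Suc k * (s - x) else (T ^^ Suc n) 0 + \<beta> ^ Suc k * (x - s))"
      if x: "x \<in> {l..u} - {1}" for x
    proof (cases "x < s")
      case True
      have y: "(T ^^ k) x = e - \<beta> ^ k * (s - x)" using eq x True by (simp add: e_def)
      have "0 < \<beta> ^ k * (s - x)" using bk True by simp
      moreover have "(s - x) * \<beta> ^ k \<le> (u - l) * \<beta> ^ k"
        using bk x s by (intro mult_right_mono) auto
      then have "\<beta> ^ k * (s - x) \<le> c" using short by (simp add: mult.commute)
      \<comment> \<open>The left piece takes values below \<open>e\<close> by at most
        \<open>c\<close>. They stay below \<open>p\<close> if \<open>e \<le> p\<close>, and above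
        \<open>p\<close> by \<open>gap1\<close> otherwise; \<open>gap0\<close> treats the right
        piece in the same way.\<close>
      ultimately have "T ((T ^^ k) x) = T' e - \<beta> ^ Suc k * (s - x)"
        using gap1[rule_format, of m, folded e_def] low[OF x] high[OF _ x] unfolding lower_map_def
        by (cases "e \<le> p") (simp_all add: y algebra_simps)
      then show ?thesis using True by (simp add: e_def)
    next
      case False
      have y: "(T ^^ k) x = d + \<beta> ^ k * (x - s)" using eq x False by (simp add: d_def)
      have "0 \<le> \<beta> ^ k * (x - s)" using bk False by simp
      moreover have "(x - s) * \<beta> ^ k \<le> (u - l) * \<beta> ^ k"
        using bk x s by (intro mult_right_mono) auto
      then have "\<beta> ^ k * (x - s) \<le> c" using short by (simp add: mult.commute)
      ultimately have "T ((T ^^ k) x) = T d + \<beta> ^ Suc k * (x - s)"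
        using gap0[rule_format, of n, folded d_def] low[OF x] high[OF _ x] beta_map_less[OF d(1)] beta_map_ge[OF _ d(2)]
        by (cases "d < p") (simp_all add: y algebra_simps)
      then show ?thesis using False by (simp add: d_def)
    qed
    with s show ?thesis by blast
  qed
qed

text \<open>
  The point 1 serves as an additional target, since for \<open>\<alpha> + \<beta> = 2\<close> the transformation maps it to 0
  and not to \<open>\<alpha> + \<beta> - 1\<close>.
\<close>

lemma beta_preimage_centres:
  assumes gap0: "\<forall>n. (T ^^ n) 0 < p \<longrightarrow> (T ^^ n) 0 + c < p"
    and gap1: "\<forall>n. p < (T' ^^ n) 1 \<longrightarrow> p < (T' ^^ n) 1 - c"
    and I: "0 \<le> l" "l \<le> u" "u \<le> 1" "(u - l) * \<beta> ^ k \<le> c"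
  shows "\<exists>C. finite C \<and> card C \<le> 3 \<and>
    (\<forall>\<delta>>0. \<forall>x\<in>{l..u}. (\<forall>y\<in>C. \<delta> \<le> \<bar>x - y\<bar> * \<beta> ^ k) \<longrightarrow> \<delta> \<le> \<bar>(T ^^ k) x - \<xi>\<bar>)"
proof -
  have bk: "0 < \<beta> ^ k" using beta_bounds by simp
  \<comment> \<open>The target is where the line through \<open>(s, d)\<close> of slope
    \<open>\<beta> ^ k\<close> has height \<xi>; it may lie outside the interval.\<close>
  have centre: "\<bar>x - (s + (\<xi> - d) / \<beta> ^ k)\<bar> * \<beta> ^ k = \<bar>d + \<beta> ^ k * (x - s) - \<xi>\<bar>" for x s d
  proof -
    have "\<bar>x - (s + (\<xi> - d) / \<beta> ^ k)\<bar> * \<beta> ^ k = \<bar>(x - (s + (\<xi> - d) / \<beta> ^ k)) * \<beta> ^ k\<bar>"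
      using bk by (simp add: abs_mult)
    also have "(x - (s + (\<xi> - d) / \<beta> ^ k)) * \<beta> ^ k = d + \<beta> ^ k * (x - s) - \<xi>"
    proof -
      have "(\<xi> - d) / \<beta> ^ k * \<beta> ^ k = \<xi> - d" using bk beta_bounds by simp
      then show ?thesis
        by (simp only: left_diff_distrib distrib_right) (simp add: algebra_simps)
    qed
    finally show ?thesis .
  qed
  from beta_orbit_at_most_one_break[OF gap0 gap1 I] show ?thesis
  proof (elim disjE exE bexE)
    fix d assume "\<forall>x\<in>{l..u} - {1}. (T ^^ k) x = d + \<beta> ^ k * (x - l)"
    then have "\<delta> \<le> \<bar>(T ^^ k) x - \<xi>\<bar>"
      if "0 < \<delta>" "x \<in> {l..u}" "\<forall>y\<in>{1, l + (\<xi> - d) / \<beta> ^ k}. \<delta> \<le> \<bar>x - y\<bar> * \<beta> ^ k" for \<delta> x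
      using that centre[of x l d] by (cases "x = 1") auto
    moreover have "card {1, l + (\<xi> - d) / \<beta> ^ k} \<le> 3"
      by (simp add: card_insert_if)
    ultimately show ?thesis by (intro exI[of _ "{1, l + (\<xi> - d) / \<beta> ^ k}"]) blast
  next
    fix s m n
    define d e where "d = (T ^^ n) 0" and "e = (T' ^^ m) 1"
    let ?C = "{1, s + (\<xi> - d) / \<beta> ^ k, s + (\<xi> - e) / \<beta> ^ k}"
    assume "\<forall>x\<in>{l..u} - {1}. (T ^^ k) x =
      (if x < s then (T' ^^ m) 1 - \<beta> ^ k * (s - x) else (T ^^ n) 0 + \<beta> ^ k * (x - s))"
    then have eq: "(T ^^ k) x = (if x < s then e else d) + \<beta> ^ k * (x - s)"
      if "x \<in> {l..u}" "x \<noteq> 1" for x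
      using that by (simp add: d_def e_def algebra_simps)
    have "\<delta> \<le> \<bar>(T ^^ k) x - \<xi>\<bar>"
      if "0 < \<delta>" "x \<in> {l..u}" "\<forall>y\<in>?C. \<delta> \<le> \<bar>x - y\<bar> * \<beta> ^ k" for \<delta> x
    proof -
      \<comment> \<open>Since 1 is a target and \<delta> is positive.\<close>
      have "x \<noteq> 1" using that by auto
      then show ?thesis
        using eq[OF that(2)] that(3) centre[of x s d] centre[of x s e] by (cases "x < s") simp_all
    qed
    moreover have "card ?C \<le> 3"
      by (simp add: card_insert_if)
    ultimately show ?thesis by (intro exI[of _ ?C]) blast
  qed
qed

section \<open>The gap around the critical point and the winning property of
  \<open>BAD\<close>\<close>

lemma critical_gap:
  assumes "finite_type (intermediate_beta_shift \<beta> \<alpha>)"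
  obtains c where "0 < c" "\<forall>n. (T ^^ n) 0 < p \<longrightarrow> (T ^^ n) 0 + c < p"
    "\<forall>n. p < (T' ^^ n) 1 \<longrightarrow> p < (T' ^^ n) 1 - c"
proof -
  define D where "D = {y. 0 < y} \<inter>
    ((\<lambda>n. p - (T ^^ n) 0) ` UNIV \<union> (\<lambda>n. (T' ^^ n) 1 - p) ` UNIV)"
  have "finite ((\<lambda>x. p - x) ` range (\<lambda>n. (T ^^ n) 0))"
    "finite ((\<lambda>x. x - p) ` range (\<lambda>n. (T' ^^ n) 1))"
    using finite_orbits[OF assms] by blast+
  then have D: "finite D" by (simp add: D_def image_image)
  \<comment> \<open>The 1 covers an empty \<open>D\<close>; halving makes the gap strict.\<close>
  define c where "c = Min (insert 1 D) / 2"
  have "0 < Min (insert 1 D)" using D by (subst Min_gr_iff) (auto simp: D_def)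
  moreover have "Min (insert 1 D) \<le> y" if "y \<in> D" for y
    using D that by (intro Min_le) auto
  ultimately have "0 < c" "\<And>y. y \<in> D \<Longrightarrow> c < y" by (fastforce simp: c_def)+
  note c = this
  show ?thesis
  proof (rule that[OF c(1)])
    have "(T ^^ n) 0 + c < p" if "(T ^^ n) 0 < p" for n
      using c(2)[of "p - (T ^^ n) 0"] that by (simp add: D_def)
    then show "\<forall>n. (T ^^ n) 0 < p \<longrightarrow> (T ^^ n) 0 + c < p" by blast
    have "p < (T' ^^ n) 1 - c" if "p < (T' ^^ n) 1" for n
      using c(2)[of "(T' ^^ n) 1 - p"] that by (simp add: D_def)
    then show "\<forall>n. p < (T' ^^ n) 1 \<longrightarrow> p < (T' ^^ n) 1 - c" by blast
  qed
qed

end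

theorem theorem1p7:
  fixes \<beta> \<alpha> \<xi> :: real
  assumes "(\<beta>, \<alpha>) \<in> param_region"
    and "finite_type (intermediate_beta_shift \<beta> \<alpha>)"
    and "\<xi> \<in> {0..1}"
  shows "winning (BAD \<beta> \<alpha> \<xi>)"
proof -
  interpret intermediate_beta \<beta> \<alpha> by unfold_locales fact
  obtain c where c: "0 < c" "\<forall>n. (T ^^ n) 0 < p \<longrightarrow> (T ^^ n) 0 + c < p"
    "\<forall>n. p < (T' ^^ n) 1 \<longrightarrow> p < (T' ^^ n) 1 - c"
    using critical_gap[OF assms(2)] by blast
  \<comment> \<open>The ratio 1/4 is the same for all parameters; the scale \<open>c\<close> comes
    from the two critical orbits.\<close>
  have "parameter_winning (1/4) (BAD \<beta> \<alpha> \<xi>)"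
  proof (rule parameter_winning_quarter[where K = 3 and c = c and b = \<beta>
        and good = "\<lambda>k \<delta> x. \<delta> \<le> \<bar>(T ^^ k) x - \<xi>\<bar>"])
    show "1 < \<beta>" "0 < c" using beta_bounds c by auto
    show "\<exists>C. finite C \<and> card C \<le> 3 \<and>
        (\<forall>\<delta>>0. \<forall>x\<in>{l..u}. (\<forall>y\<in>C. \<delta> \<le> \<bar>x - y\<bar> * \<beta> ^ k) \<longrightarrow> \<delta> \<le> \<bar>(T ^^ k) x - \<xi>\<bar>)"
      if "0 \<le> l" "l < u" "u \<le> 1" "(u - l) * \<beta> ^ k \<le> c" for k l u
      using that by (intro beta_preimage_centres[OF c(2,3)]) auto
    show "x \<in> BAD \<beta> \<alpha> \<xi>"
      if "x \<in> {0..1}" "0 < \<delta>" "\<And>k. \<delta> \<le> \<bar>(T ^^ k) x - \<xi>\<bar>" for x \<delta>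
    proof -
      have "\<not> dist ((T ^^ n) x) \<xi> < \<delta>" for n
        using that(3)[of n] by (simp add: dist_real_def)
      then have "\<xi> \<notin> closure (range (\<lambda>n. (T ^^ n) x))"
        using that(2) by (auto simp: closure_approachable)
      then show ?thesis using that(1) by (simp add: BAD_def)
    qed
  qed
  then show ?thesis unfolding winning_def by (intro bexI[of _ "1/4"]) auto
qed

end
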